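(* Let $A\in\mathbb{R}^{n\times n}$ be nonsingular, and let $u$ and $v$ be left and right singular vectors, respectively, of $A$ corresponding to its smallest singular value $\sigma_{\min}(A)$. Let $y,z\in\{\pm1\}^n$ be the sign vectors $y=\mathrm{sgn}(u)$, $z=\mathrm{sgn}(v)$. Then $$r(A)\le\frac{1}{\rho_0(A^{-1}yz^T)}.$$
   Context: The regularity radius of $A$ is $r(A)=\min\{\delta\ge 0 : [A-\delta ee^T,A+\delta ee^T]\text{ is singular}\}$, where $e=(1,\dots,1)^T$, $[A-\delta ee^T,A+\delta ee^T]$ is the set of all real matrices $A'$ with $A-\delta ee^T\le A'\le A+\delta ee^T$ entrywise, and this set is called singular if it contains at least one singular matrix. For a real square matrix $M$, $\rho_0(M)$ is the real spectral radius: the maximum of the absolute values of the real eigenvalues of $M$, and $0$ if $M$ has no real eigenvalue. The convention $1/0=\infty$ is used. The sign function is applied entrywise; at a zero entry of $u$ or $v$ the sign is chosen as either $1$ or $-1$. *)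

theory Defs
  imports "HOL-Analysis.Analysis"
begin

definition outer_prod :: "real ^ 'n \<Rightarrow> real ^ 'm \<Rightarrow> real ^ 'm ^ 'n" where
  "outer_prod x y = (\<chi> i j. x $ i * y $ j)"

definition singular_matrix_set :: "(real ^ 'n ^ 'n) set \<Rightarrow> bool" where
  "singular_matrix_set S \<longleftrightarrow> (\<exists>A' \<in> S. \<not> invertible A')"

(* The vector 1 is the all-ones vector e, so outer_prod 1 1 is the all-ones matrix.
   The order on vectors and matrices is entrywise, so {L..U} is an interval matrix.
   LEAST yields the minimum of the set: a least such delta exists for every A. *)
definition regularity_radius :: "real ^ 'n ^ 'n \<Rightarrow> real" where
  "regularity_radius A = (LEAST \<delta>. 0 \<le> \<delta> \<and>
     singular_matrix_set {A - \<delta> *\<^sub>R outer_prod 1 1 ..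
                          A + \<delta> *\<^sub>R outer_prod 1 1})"

definition real_eigenvalues :: "real ^ 'n ^ 'n \<Rightarrow> real set" where
  "real_eigenvalues M = {\<mu>. \<exists>x. x \<noteq> 0 \<and> M *v x = \<mu> *\<^sub>R x}"

definition real_spectral_radius :: "real ^ 'n ^ 'n \<Rightarrow> real" where
  "real_spectral_radius M =
     (if real_eigenvalues M = {} then 0 else Max (abs ` real_eigenvalues M))"

definition singular_values :: "real ^ 'n ^ 'n \<Rightarrow> real set" where
  "singular_values A = sqrt ` real_eigenvalues (transpose A ** A)"

definition sigma_min :: "real ^ 'n ^ 'n \<Rightarrow> real" where
  "sigma_min A = Min (singular_values A)"

(* u is the left and v the right vector of the pair, normalised as in the SVD. *)
definition singular_vectors :: "real ^ 'n ^ 'n \<Rightarrow> real \<Rightarrow> real ^ 'n \<Rightarrow> real ^ 'n \<Rightarrow> bool" where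
  "singular_vectors A \<sigma> u v \<longleftrightarrow> norm u = 1 \<and> norm v = 1 \<and>
     A *v v = \<sigma> *\<^sub>R u \<and> transpose A *v u = \<sigma> *\<^sub>R v"

(* A relation, not a function: at a zero entry of u either sign is allowed. *)
definition is_sign_vector :: "real ^ 'n \<Rightarrow> real ^ 'n \<Rightarrow> bool" where
  "is_sign_vector y u \<longleftrightarrow>
     (\<forall>i. y $ i \<in> {1, -1} \<and> (u $ i \<noteq> 0 \<longrightarrow> y $ i = sgn (u $ i)))"

end

theory Submission
  imports Defs
begin

text \<open>
  The only possibly nonzero eigenvalue of the rank-one matrix \<open>A\<^sup>-\<^sup>1 y z\<^sup>T\<close> is
  \<open>t = z\<^sup>T A\<^sup>-\<^sup>1 y\<close>. If \<open>t \<noteq> 0\<close>, the matrix \<open>A - (1/t) y z\<^sup>T\<close> annihilates \<open>A\<^sup>-\<^sup>1 y\<close>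
  and differs from \<open>A\<close> by exactly \<open>1/\<bar>t\<bar>\<close> in every entry, because \<open>y\<close> and \<open>z\<close> are sign
  vectors. If \<open>t = 0\<close>, the bound is infinite.
\<close>

lemma outer_prod_mult_vec:
  fixes x :: "real ^ 'n" and y w :: "real ^ 'm"
  shows "outer_prod x y *v w = (y \<bullet> w) *\<^sub>R x"
  by (simp add: vec_eq_iff outer_prod_def matrix_vector_mult_def inner_vec_def
      sum_distrib_left mult_ac)

lemma matrix_inv_right:
  fixes A :: "real ^ 'n ^ 'n"
  assumes "invertible A"
  shows "A ** matrix_inv A = mat 1"
  using someI_ex[OF assms[unfolded invertible_def]] by (simp add: matrix_inv_def)

text \<open>The Leibniz expansion is a polynomial in the entries. Continuity makes
  \<open>det M = 0\<close> a closed condition, as compactness arguments require.\<close>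

lemma continuous_on_det:
  fixes f :: "'a :: topological_space \<Rightarrow> real ^ 'n ^ 'n"
  assumes "continuous_on S f"
  shows "continuous_on S (\<lambda>x. det (f x))"
  unfolding det_def by (intro continuous_intros assms)

lemma mem_interval_matrix_iff:
  fixes A M :: "real ^ 'n ^ 'n"
  shows "M \<in> {A - d *\<^sub>R outer_prod 1 1 .. A + d *\<^sub>R outer_prod 1 1} \<longleftrightarrow>
    (\<forall>i j. \<bar>M $ i $ j - A $ i $ j\<bar> \<le> d)"
proof -
  have "\<bar>m - a\<bar> \<le> d \<longleftrightarrow> a - d \<le> m \<and> m \<le> a + d" for m a :: real
    by linarith
  then show ?thesis
    by (auto simp: less_eq_vec_def outer_prod_def)
qed

text \<open>Over the reals \<open>LEAST\<close> bounds nothing unless a least element exists, so the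
  witness \<open>M\<close> alone does not suffice. Its existence makes a compact set nonempty, and
  there the minimum is attained.\<close>

lemma regularity_radius_le:
  fixes A :: "real ^ 'n ^ 'n"
  assumes "\<not> invertible M" and close: "\<And>i j. \<bar>M $ i $ j - A $ i $ j\<bar> \<le> d"
  shows "regularity_radius A \<le> d"
proof -
  define P where "P d \<longleftrightarrow> 0 \<le> d \<and>
     singular_matrix_set {A - d *\<^sub>R outer_prod 1 1 .. A + d *\<^sub>R outer_prod 1 1}" for d
  have P_iff: "P d \<longleftrightarrow> 0 \<le> d \<and> (\<exists>M. (\<forall>i j. \<bar>M $ i $ j - A $ i $ j\<bar> \<le> d) \<and> det M = 0)" for d
    unfolding P_def singular_matrix_set_def Bex_def mem_interval_matrix_iff
    by (simp add: invertible_det_nz)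
  \<comment> \<open>Index types are nonempty, so any entry will do: \<open>d\<close> dominates an
    absolute value.\<close>
  have "0 \<le> d"
    using close[of undefined undefined] by linarith
  have "det M = 0"
    using assms(1) by (simp add: invertible_det_nz)
  \<comment> \<open>The least radius is the minimum of \<open>fst\<close> over this compact set of pairs (radius, singular matrix).\<close>
  define K where "K = ({0..d} \<times> {A - d *\<^sub>R outer_prod 1 1 .. A + d *\<^sub>R outer_prod 1 1}) \<inter>
    {p. (\<forall>i j. \<bar>snd p $ i $ j - A $ i $ j\<bar> \<le> fst p) \<and> det (snd p) = 0}"
  have "closed {p :: real \<times> (real^'n^'n). (\<forall>i j. \<bar>snd p $ i $ j - A $ i $ j\<bar> \<le> fst p) \<and> det (snd p) = 0}"
    by (intro closed_Collect_conj closed_Collect_all closed_Collect_le closed_Collect_eq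
        continuous_on_det continuous_intros)
  moreover have "compact {A - d *\<^sub>R outer_prod 1 1 .. A + d *\<^sub>R outer_prod 1 1}"
    by (metis compact_cbox interval_cbox)
  ultimately have "compact K"
    unfolding K_def by (intro compact_Int_closed compact_Times compact_Icc)
  moreover have "(d, M) \<in> K"
    using close \<open>0 \<le> d\<close> \<open>det M = 0\<close> unfolding K_def
    by (simp add: mem_interval_matrix_iff del: atLeastAtMost_iff) simp
  ultimately obtain p where p: "p \<in> K" "\<And>q. q \<in> K \<Longrightarrow> fst p \<le> fst q"
    using continuous_attains_inf[of K fst] continuous_on_fst[OF continuous_on_id] by blast
  have "P (fst p)" "fst p \<le> d"
    using p(1) unfolding P_iff K_def by auto
  \<comment> \<open>Compactness of \<open>K\<close> rests on cutting radii off at \<open>d\<close>.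
    Nothing is lost: a radius above \<open>d\<close> already exceeds \<open>fst p\<close>.\<close>
  moreover have "fst p \<le> c" if c: "P c" for c
  proof (cases "c \<le> d")
    case True
    obtain N where N: "\<forall>i j. \<bar>N $ i $ j - A $ i $ j\<bar> \<le> c" "det N = 0" and "0 \<le> c"
      using c unfolding P_iff by blast
    moreover have "\<forall>i j. \<bar>N $ i $ j - A $ i $ j\<bar> \<le> d"
      using N(1) True order_trans by blast
    ultimately have "(c, N) \<in> K"
      using True by (simp add: K_def mem_interval_matrix_iff del: atLeastAtMost_iff) simp
    then show ?thesis
      using p(2) by fastforce
  next
    case False
    with \<open>fst p \<le> d\<close> show ?thesis by simp
  qed
  ultimately have "(LEAST d. P d) = fst p"
    by (intro Least_equality)
  with \<open>fst p \<le> d\<close> show ?thesis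
    unfolding regularity_radius_def P_def by simp
qed

text \<open>The vector \<open>w\<close> is an eigenvector for \<open>z \<bullet> w\<close>, and the
  only other possible eigenvalue is 0, which cannot raise the maximum.\<close>

lemma real_spectral_radius_outer_prod:
  fixes w z :: "real ^ 'n"
  assumes "w \<noteq> 0"
  shows "real_spectral_radius (outer_prod w z) = \<bar>z \<bullet> w\<bar>"
proof -
  let ?E = "real_eigenvalues (outer_prod w z)"
  have mem: "z \<bullet> w \<in> ?E"
    using assms by (auto simp: real_eigenvalues_def outer_prod_mult_vec)
  have sub: "?E \<subseteq> {0, z \<bullet> w}"
  proof
    fix \<mu> assume "\<mu> \<in> ?E"
    then obtain x where x: "x \<noteq> 0" "(z \<bullet> x) *\<^sub>R w = \<mu> *\<^sub>R x"
      by (auto simp: real_eigenvalues_def outer_prod_mult_vec)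
    \<comment> \<open>Pairing with \<open>z\<close> gives a scalar equation. Either
      \<open>z \<bullet> x\<close> cancels, or it vanishes and then \<mu> is 0 because
      \<open>x\<close> is nonzero.\<close>
    have "(z \<bullet> x) * (z \<bullet> w) = \<mu> * (z \<bullet> x)"
      using arg_cong[OF x(2), of "inner z"] by simp
    then show "\<mu> \<in> {0, z \<bullet> w}"
      using x by (cases "z \<bullet> x = 0") auto
  qed
  have "Max (abs ` ?E) = \<bar>z \<bullet> w\<bar>"
  proof (rule Max_eqI)
    show "finite (abs ` ?E)"
      using sub by (meson finite.emptyI finite.insertI finite_imageI finite_subset)
  qed (use sub mem in auto)
  then show ?thesis
    using mem unfolding real_spectral_radius_def by auto
qed

theorem mainTheorem6:
  fixes A :: "real ^ 'n ^ 'n" and u v y z :: "real ^ 'n"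
  assumes "invertible A"
    and "singular_vectors A (sigma_min A) u v"
    and "is_sign_vector y u"
    and "is_sign_vector z v"
  shows "ereal (regularity_radius A)
    \<le> 1 / ereal (real_spectral_radius (matrix_inv A ** outer_prod y z))"
proof -
  define w where "w = matrix_inv A *v y"
  define t where "t = z \<bullet> w"
  have Aw: "A *v w = y"
    using assms(1) by (simp add: w_def matrix_vector_mul_assoc matrix_inv_right)
  have abs_y: "\<bar>y $ i\<bar> = 1" and abs_z: "\<bar>z $ i\<bar> = 1" for i
    using assms(3,4)[unfolded is_sign_vector_def, rule_format, of i] by auto
  \<comment> \<open>Otherwise \<open>y\<close> would be 0, but its entries have modulus 1.\<close>
  have "w \<noteq> 0"
    using Aw abs_y by fastforce
  have "matrix_inv A ** outer_prod y z = outer_prod w z"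
    by (simp add: matrix_eq w_def outer_prod_mult_vec matrix_vector_mult_scaleR
        flip: matrix_vector_mul_assoc)
  then have radius: "real_spectral_radius (matrix_inv A ** outer_prod y z) = \<bar>t\<bar>"
    using real_spectral_radius_outer_prod[OF \<open>w \<noteq> 0\<close>] by (simp add: t_def)
  show ?thesis
  proof (cases "t = 0")
    case True
    then show ?thesis
      by (simp add: radius divide_ereal_def flip: zero_ereal_def)
  next
    case False
    define M where "M = A - (1 / t) *\<^sub>R outer_prod y z"
    have "M *v w = 0"
      using False by (simp add: M_def matrix_vector_mult_diff_rdistrib Aw outer_prod_mult_vec
          flip: scaleR_matrix_vector_assoc t_def)
    then have "\<not> invertible M"
      using \<open>w \<noteq> 0\<close> by (metis invertible_def matrix_left_invertible_ker)
    moreover have "\<bar>M $ i $ j - A $ i $ j\<bar> \<le> 1 / \<bar>t\<bar>" for i j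
      by (simp add: M_def outer_prod_def abs_mult abs_y abs_z)
    ultimately have "regularity_radius A \<le> 1 / \<bar>t\<bar>"
      by (rule regularity_radius_le)
    then show ?thesis
      using False by (simp add: radius one_ereal_def)
  qed
qed

end
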